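(* For $\lambda>0$ let $p_k=e^{-\lambda}\lambda^k/k!$, $k\ge0$, be the Poisson($\lambda$) mass function, and let $$C_0^{\rm P}(\lambda):=\sup_{k\ge1}\frac{F_{k-1}Q_k}{k\,p_k},\qquad F_{k-1}:=\sum_{j=0}^{k-1}p_j,\qquad Q_k:=\sum_{j\ge k}p_j .$$ Then for every $\lambda>0$, $$C_0^{\rm P}(\lambda)\le\frac1{\sqrt{2\lambda+\kappa_{\rm P}(\lambda)}},\qquad\text{where}\quad \kappa_{\rm P}(\lambda):=\min_{k\ge1,\,k\in\mathbb N}\left\{(k-\lambda)^2+\left(\frac{\lambda}{k+\lambda}\right)^2\right\}.$$ In particular, $$C_0^{\rm P}(\lambda)\le\min\left\{1,\frac1{\sqrt{2\lambda+c_*}}\right\},\qquad\text{where}\quad c_*:=\min_{0\le x\le1}\left\{(1-x)^2+\left(\frac{x}{1+x}\right)^2\right\}=0.2333389940\ldots$$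
   Context: $C_0^{\rm P}(\lambda)$ equals the uniform Stein solution factor $\sup_{A\subseteq\mathbb N_0}\|g_A\|_\infty$, where $g_A$ with $g_A(0)=0$ solves $\lambda g_A(k+1)-kg_A(k)=\mathbf 1_A(k)-\mathbb P(Z\in A)$, $k\ge0$, $Z\sim\operatorname{Po}(\lambda)$. *)

theory Defs
  imports "HOL-Probability.Probability"
begin

definition poisson_mass :: "real \<Rightarrow> nat \<Rightarrow> real" where
  "poisson_mass lam k = exp (- lam) * lam ^ k / fact k"

definition poisson_cdf :: "real \<Rightarrow> nat \<Rightarrow> real" where
  "poisson_cdf lam k = (\<Sum>j\<le>k. poisson_mass lam j)"

definition poisson_tail :: "real \<Rightarrow> nat \<Rightarrow> real" where
  "poisson_tail lam k = (\<Sum>\<^sub>\<infinity>j\<in>{k..}. poisson_mass lam j)"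

text \<open>The supremum is taken in the extended reals, so that it is meaningful without
  assuming boundedness; an upper bound on it includes the claim that it is finite.\<close>

definition C0P :: "real \<Rightarrow> ereal" where
  "C0P lam = (SUP k\<in>{1..}. ereal (poisson_cdf lam (k - 1) * poisson_tail lam k / (real k * poisson_mass lam k)))"

text \<open>The two minima below are defined as infima of nonempty sets of nonnegative reals; that they
  are attained, i.e. that they are minima, is part of the theorem.\<close>

definition kappa_objective :: "real \<Rightarrow> nat \<Rightarrow> real" where
  "kappa_objective lam k = (real k - lam)\<^sup>2 + (lam / (real k + lam))\<^sup>2"

definition kappaP :: "real \<Rightarrow> real" where
  "kappaP lam = (INF k\<in>{1..}. kappa_objective lam k)"

definition c_star_objective :: "real \<Rightarrow> real" where
  "c_star_objective x = (1 - x)\<^sup>2 + (x / (1 + x))\<^sup>2"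

definition c_star :: real where
  "c_star = (INF x\<in>{0..1}. c_star_objective x)"

lemma poisson_mass_eq_pmf:
  assumes "lam > 0"
  shows "poisson_mass lam k = pmf (poisson_pmf lam) k"
  using assms by (simp add: poisson_mass_def)

lemma poisson_cdf_eq_prob:
  assumes "lam > 0"
  shows "poisson_cdf lam k = measure_pmf.prob (poisson_pmf lam) {..k}"
  using assms by (simp add: poisson_cdf_def poisson_mass_eq_pmf measure_measure_pmf_finite)

lemma poisson_tail_eq_prob:
  assumes "lam > 0"
  shows "poisson_tail lam k = measure_pmf.prob (poisson_pmf lam) {k..}"
  using assms
  by (simp only: poisson_tail_def poisson_mass_eq_pmf measure_pmf_conv_infsetsum
        infsetsum_infsum pmf_abs_summable)

end

theory Submission
  imports Defs
begin

text \<open>Put \<open>a = k * p\<^sub>k / F\<^sub>k\<^sub>-\<^sub>1\<close> and \<open>b = k * p\<^sub>k / Q\<^sub>k\<close>. Since \<open>F\<^sub>k\<^sub>-\<^sub>1 + Q\<^sub>k = 1\<close>, the reciprocal of the ratio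
  in the supremum is \<open>a + b\<close>, and it is at least \<open>k - lam\<close>, so the supremum is attained at some \<open>k\<close>.
  Comparing the ratio at this \<open>k\<close> with its two neighbours gives
  \<open>(k + a) * (k - b) \<le> lam * k\<close> and \<open>(lam - a) * (lam + b) \<le> lam * (k - 1)\<close>, and minimising
  \<open>a + b\<close> under these two constraints gives exactly \<open>(a + b)\<^sup>2 \<ge> 2 * lam + (k - lam)\<^sup>2 + (lam / (k + lam))\<^sup>2\<close>.\<close>

text \<open>Beyond a large enough \<open>N\<close> the growth bound lifts \<open>f\<close> above
  \<open>f 1\<close>, so the minimum over \<open>{1..Suc N}\<close> is global. Serves both
  \<open>kappa_objective\<close> and the reciprocal of \<open>stein_ratio\<close>.\<close>

lemma attains_min_if_linear_growth:
  fixes f :: "nat \<Rightarrow> real"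
  assumes growth: "\<And>k. k \<ge> 1 \<Longrightarrow> real k - c \<le> f k"
  shows "\<exists>k\<ge>1. \<forall>m\<ge>1. f k \<le> f m"
proof -
  obtain N :: nat where N: "c + f 1 \<le> real N"
    using real_arch_simple by blast
  have "\<exists>k\<in>{1..Suc N}. \<forall>m\<in>{1..Suc N}. f k \<le> f m"
    using arg_min_if_finite[of "{1..Suc N}" f]
    by (metis atLeastAtMost_iff empty_iff finite_atLeastAtMost le_add1 linorder_not_le plus_1_eq_Suc order_refl)
  then obtain k where k: "k \<in> {1..Suc N}" "\<And>m. m \<in> {1..Suc N} \<Longrightarrow> f k \<le> f m"
    by blast
  have "f k \<le> f m" if "m \<ge> 1" for m
  proof (cases "m \<le> Suc N")
    case True
    then show ?thesis using k that by simp
  next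
    case False
    then have "f 1 \<le> f m" using N growth[OF that] by simp
    moreover have "f k \<le> f 1" using k(2)[of 1] by simp
    ultimately show ?thesis by simp
  qed
  then show ?thesis using k(1) by auto
qed

section \<open>Poisson masses, distribution function and tails\<close>

lemma poisson_mass_pos: "lam > 0 \<Longrightarrow> poisson_mass lam k > 0"
  by (simp add: poisson_mass_def)

lemma poisson_mass_Suc:
  "real (Suc k) * poisson_mass lam (Suc k) = lam * poisson_mass lam k"
proof -
  have "fact (Suc k) = real (Suc k) * fact k" by (simp only: fact_Suc of_nat_mult)
  then show ?thesis unfolding poisson_mass_def by (simp del: of_nat_Suc fact_Suc)
qed

lemma poisson_cdf_0: "poisson_cdf lam 0 = poisson_mass lam 0"
  by (simp add: poisson_cdf_def)

lemma poisson_cdf_Suc: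
  "poisson_cdf lam (Suc k) = poisson_cdf lam k + poisson_mass lam (Suc k)"
  by (simp add: poisson_cdf_def)

lemma poisson_cdf_pos: "lam > 0 \<Longrightarrow> poisson_cdf lam k > 0"
  unfolding poisson_cdf_def by (intro sum_pos) (auto simp: poisson_mass_pos)

lemma poisson_cdf_add_tail:
  assumes "lam > 0"
  shows "poisson_cdf lam k + poisson_tail lam (Suc k) = 1"
proof -
  have "{Suc k..} = UNIV - {..k}" by auto
  then have "poisson_tail lam (Suc k) = 1 - poisson_cdf lam k"
    using measure_pmf.prob_compl[of "{..k}" "poisson_pmf lam"] assms
    by (simp add: poisson_tail_eq_prob poisson_cdf_eq_prob)
  then show ?thesis by simp
qed

lemma poisson_tail_Suc:
  assumes "lam > 0"
  shows "poisson_tail lam k = poisson_mass lam k + poisson_tail lam (Suc k)"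
proof -
  have "{k..} = insert k {Suc k..}" by auto
  then have "measure_pmf.prob (poisson_pmf lam) {k..} = measure_pmf.prob (poisson_pmf lam) {k} + measure_pmf.prob (poisson_pmf lam) {Suc k..}"
    using measure_pmf.finite_measure_Union[of "{k}" "poisson_pmf lam" "{Suc k..}"] by simp
  then show ?thesis
    using assms by (simp add: poisson_tail_eq_prob poisson_mass_eq_pmf measure_pmf_single)
qed

lemma poisson_tail_pos:
  assumes "lam > 0"
  shows "poisson_tail lam k > 0"
proof -
  have "poisson_tail lam (Suc k) \<ge> 0"
    using assms by (simp add: poisson_tail_eq_prob)
  then show ?thesis
    using poisson_tail_Suc[OF assms, of k] poisson_mass_pos[OF assms, of k] by simp
qed

lemma summable_on_poisson_mass:
  assumes "lam > 0"
  shows "poisson_mass lam summable_on A"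
proof -
  have "poisson_mass lam = pmf (poisson_pmf lam)"
    using assms by (auto simp: poisson_mass_eq_pmf)
  then show ?thesis
    using pmf_abs_summable[of "poisson_pmf lam" A] abs_summable_equivalent abs_summable_summable
    by metis
qed

text \<open>Holds termwise after shifting the index: for \<open>j \<ge> k\<close>, replacing the
  factor \<open>Suc k\<close> by \<open>Suc j\<close> only increases the term, and
  \<open>poisson_mass_Suc\<close> turns the result into
  \<open>lam * poisson_mass lam j\<close>.\<close>

lemma poisson_tail_Suc_le:
  assumes "lam > 0"
  shows "real (Suc k) * poisson_tail lam (Suc k) \<le> lam * poisson_tail lam k"
proof -
  have img: "{Suc k..} = Suc ` {k..}"
  proof (intro equalityI subsetI)
    fix x assume "x \<in> {Suc k..}"
    then show "x \<in> Suc ` {k..}" by (cases x) auto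
  qed auto
  have shift: "poisson_tail lam (Suc k) = (\<Sum>\<^sub>\<infinity>j\<in>{k..}. poisson_mass lam (Suc j))"
    unfolding poisson_tail_def img by (subst infsum_reindex) (auto simp: o_def)
  have summ: "(\<lambda>j. poisson_mass lam (Suc j)) summable_on {k..}"
    using summable_on_poisson_mass[OF assms, of "Suc ` {k..}"]
    by (subst (asm) summable_on_reindex) (auto simp: o_def)
  have "(\<Sum>\<^sub>\<infinity>j\<in>{k..}. real (Suc k) * poisson_mass lam (Suc j))
      \<le> (\<Sum>\<^sub>\<infinity>j\<in>{k..}. lam * poisson_mass lam j)"
  proof (rule infsum_mono)
    fix j assume "j \<in> {k..}"
    then have "real (Suc k) * poisson_mass lam (Suc j) \<le> real (Suc j) * poisson_mass lam (Suc j)"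
      using poisson_mass_pos[OF assms, of "Suc j"] by (intro mult_right_mono) auto
    then show "real (Suc k) * poisson_mass lam (Suc j) \<le> lam * poisson_mass lam j"
      by (simp only: poisson_mass_Suc)
  qed (intro summable_on_cmult_right summ summable_on_poisson_mass assms)+
  then show ?thesis
    unfolding shift unfolding poisson_tail_def by (simp add: infsum_cmult_right' del: of_nat_Suc)
qed

lemma poisson_mean_excess:
  assumes "lam > 0"
  shows "(real (Suc k) - lam) * poisson_tail lam (Suc k) \<le> lam * poisson_mass lam k"
  using poisson_tail_Suc_le[OF assms, of k] poisson_tail_Suc[OF assms, of k]
  by (simp add: algebra_simps)

section \<open>The constrained minimisation\<close>

text \<open>With \<open>w = k - l + a - b\<close> the hypotheses read \<open>a * b \<ge> k * w\<close> and \<open>a * b \<ge> l * (1 - w)\<close>. The resulting lower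
  bound of \<open>(a + b)\<^sup>2 = (a - b)\<^sup>2 + 4 * a * b\<close> is convex in \<open>w\<close> and smallest where the two
  constraints meet, at \<open>w = l / (k + l)\<close>.\<close>

lemma stationary_sum_bound:
  fixes a b k l :: real
  assumes "k \<ge> 1" "l > 0"
    and right: "(k + a) * (k - b) \<le> l * k"
    and left: "(l - a) * (l + b) \<le> l * (k - 1)"
  shows "2 * l + ((k - l)\<^sup>2 + (l / (k + l))\<^sup>2) \<le> (a + b)\<^sup>2"
proof -
  define w0 e where "w0 = l / (k + l)" and "e = k - l + a - b - w0"
  have w0: "w0 * (k + l) = l" "0 < w0" "w0 \<le> 1"
    using assms by (auto simp: w0_def)
  have r: "k * (w0 + e) \<le> a * b" and lf: "l * (1 - (w0 + e)) \<le> a * b"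
    using right left unfolding e_def by (simp_all add: algebra_simps)
  have sq: "(a + b)\<^sup>2 = (w0 + e - (k - l))\<^sup>2 + 4 * (a * b)"
    unfolding e_def by (simp add: power2_eq_square algebra_simps)
  have val: "2 * l + ((k - l)\<^sup>2 + w0\<^sup>2) = (w0 - (k - l))\<^sup>2 + 4 * (k * w0)"
    using w0(1) by (simp add: power2_eq_square algebra_simps)
  have cross: "k * w0 = l * (1 - w0)"
    using w0(1) by (simp add: algebra_simps)
  show ?thesis
  \<comment> \<open>\<open>e\<close> measures the distance from the meeting point \<open>w0\<close>.
    The constraint \<open>r\<close> is used for \<open>e \<ge> 0\<close> and \<open>lf\<close> for
    \<open>e < 0\<close>; in either case the term linear in \<open>e\<close> is nonnegative.\<close>
  proof (cases "e \<ge> 0")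
    case True
    have "(w0 + e - (k - l))\<^sup>2 + 4 * (k * (w0 + e))
        = (w0 - (k - l))\<^sup>2 + 4 * (k * w0) + 2 * e * (w0 + k + l) + e\<^sup>2"
      by (simp add: power2_eq_square algebra_simps)
    moreover have "0 \<le> 2 * e * (w0 + k + l)"
      using True w0 assms by simp
    ultimately show ?thesis
      using r sq val zero_le_power2[of e] unfolding w0_def[symmetric] by linarith
  next
    case False
    have "(w0 + e - (k - l))\<^sup>2 + 4 * (l * (1 - (w0 + e)))
        = (w0 - (k - l))\<^sup>2 + 4 * (l * (1 - w0)) + 2 * (- e) * (k + l - w0) + e\<^sup>2"
      by (simp add: power2_eq_square algebra_simps)
    moreover have "0 \<le> 2 * (- e) * (k + l - w0)"
      using False w0 assms by (intro mult_nonneg_nonneg) auto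
    ultimately show ?thesis
      using lf sq val cross zero_le_power2[of e] unfolding w0_def[symmetric] by linarith
  qed
qed

section \<open>The minima \<open>kappaP\<close> and \<open>c_star\<close>\<close>

text \<open>Completing the square in \<open>lam\<close> leaves \<open>2 * k - 1\<close>. This yields
  the constant 1 in the final minimum and keeps the radicand with \<open>kappaP\<close>
  positive.\<close>

lemma two_lam_add_kappa_objective_ge_1:
  assumes "k \<ge> 1"
  shows "1 \<le> 2 * lam + kappa_objective lam k"
proof -
  have "2 * lam + (real k - lam)\<^sup>2 = (lam - (real k - 1))\<^sup>2 + 2 * real k - 1"
    by (simp add: power2_eq_square algebra_simps)
  moreover have "0 \<le> (lam - (real k - 1))\<^sup>2" "0 \<le> (lam / (real k + lam))\<^sup>2" "real k \<ge> 1"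
    using assms by auto
  ultimately show ?thesis
    unfolding kappa_objective_def by linarith
qed

lemma kappaP_attained:
  "\<exists>k\<ge>1. kappaP lam = kappa_objective lam k \<and> (\<forall>m\<ge>1. kappa_objective lam k \<le> kappa_objective lam m)"
proof -
  have "real k - (lam + 1) \<le> kappa_objective lam k" for k
  proof -
    \<comment> \<open>The first square gives \<open>t\<^sup>2 \<ge> t - 1/4\<close> at
      \<open>t = k - lam\<close>, hence linear growth.\<close>
    have "0 \<le> (real k - lam - 1/2)\<^sup>2" "0 \<le> (lam / (real k + lam))\<^sup>2" by simp_all
    then show ?thesis
      unfolding kappa_objective_def by (simp add: power2_eq_square algebra_simps)
  qed
  then obtain k where k: "k \<ge> 1" "\<forall>m\<ge>1. kappa_objective lam k \<le> kappa_objective lam m"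
    using attains_min_if_linear_growth[of "lam + 1" "kappa_objective lam"] by blast
  then have "kappaP lam = kappa_objective lam k"
    unfolding kappaP_def by (intro cInf_eq_minimum) auto
  with k show ?thesis by blast
qed

lemma c_star_attained:
  "\<exists>x\<in>{0..1}. c_star = c_star_objective x \<and> (\<forall>y\<in>{0..1}. c_star_objective x \<le> c_star_objective y)"
proof -
  have "continuous_on {0..1} c_star_objective"
    unfolding c_star_objective_def by (intro continuous_intros) auto
  then obtain x where x: "x \<in> {0..1}" "\<forall>y\<in>{0..1}. c_star_objective x \<le> c_star_objective y"
    using continuous_attains_inf[of "{0..1::real}" c_star_objective] by auto
  then have "c_star = c_star_objective x"
    unfolding c_star_def by (intro cInf_eq_minimum) auto
  with x show ?thesis by blast
qed

lemma c_star_le_objective: "x \<in> {0..1} \<Longrightarrow> c_star \<le> c_star_objective x"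
  using c_star_attained by auto

text \<open>For \<open>lam\<close> outside the interval \<open>(k - 1, k)\<close> one of the two
  squares alone exceeds an endpoint value of \<open>c_star_objective\<close>: 1 at
  \<open>x = 0\<close> or 1/4 at \<open>x = 1\<close>. Inside it, \<open>x = lam - (k - 1)\<close>
  makes the first squares equal.\<close>

lemma c_star_le_kappa_objective:
  assumes "lam > 0" "k \<ge> 1"
  shows "c_star \<le> kappa_objective lam k"
proof -
  consider "lam \<le> real k - 1" | "real k \<le> lam" | "real k - 1 < lam" "lam < real k"
    by linarith
  then show ?thesis
  proof cases
    case 1
    have "1 \<le> (real k - lam)\<^sup>2"
      using 1 by (intro one_le_power) auto
    moreover have "c_star \<le> 1" using c_star_le_objective[of 0] by (simp add: c_star_objective_def)
    ultimately show ?thesis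
      unfolding kappa_objective_def using zero_le_power2[of "lam / (real k + lam)"] by linarith
  next
    case 2
    have "(1/2 :: real)\<^sup>2 \<le> (lam / (real k + lam))\<^sup>2"
      using 2 assms by (intro power_mono) (auto simp: field_simps)
    moreover have "c_star \<le> 1/4" using c_star_le_objective[of 1] by (simp add: c_star_objective_def power2_eq_square)
    ultimately show ?thesis
      unfolding kappa_objective_def using zero_le_power2[of "real k - lam"]
      by (simp only: power_one_over power2_eq_square[of 2])
  next
    case 3
    define x where "x = lam - (real k - 1)"
    have x: "0 < x" "x < 1" using 3 by (auto simp: x_def)
    \<comment> \<open>In terms of \<open>x\<close>, \<open>lam / (k + lam)\<close> is
      \<open>(x + (k - 1)) / (1 + x + 2 * (k - 1))\<close>; cross-multiplying reduces the comparison
      with \<open>x / (1 + x)\<close> to this inequality.\<close>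
    have "(real k - 1) * x \<le> real k - 1"
      using x assms by (intro mult_left_le) auto
    then have "x / (1 + x) \<le> lam / (real k + lam)"
      using x assms by (simp add: field_simps x_def)
    then have "(x / (1 + x))\<^sup>2 \<le> (lam / (real k + lam))\<^sup>2"
      using x by (intro power_mono) auto
    moreover have "1 - x = real k - lam" by (simp add: x_def)
    ultimately have "c_star_objective x \<le> kappa_objective lam k"
      unfolding kappa_objective_def c_star_objective_def by simp
    then show ?thesis using c_star_le_objective[of x] x by simp
  qed
qed

lemma c_star_lower: "0.2333389940 \<le> c_star"
proof -
  have "0.2333389940 \<le> c_star_objective x" if "x \<in> {0..1}" for x
  proof -
    text \<open>The cleared inequality is \<open>(x - m)\<^sup>2\<close> times a positive quadratic plus a small
      positive linear remainder, where \<open>m\<close> approximates the minimiser.\<close>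
    define m c e :: real where "m = 0.866760399174" and "c = 0.2333389940" and "e = 3 * m\<^sup>2 - (1 + c)"
    have x: "0 \<le> x" "x \<le> 1" using that by auto
    \<comment> \<open>Polynomial division by \<open>(x - m)\<^sup>2\<close>; the value of
      \<open>e\<close> is forced by the coefficient of \<open>x\<^sup>2\<close>.\<close>
    have eq: "(1 - x)\<^sup>2 * (1 + x)\<^sup>2 + x\<^sup>2 - c * (1 + x)\<^sup>2
        = (x - m)\<^sup>2 * (x\<^sup>2 + 2 * m * x + e)
          + ((2 * m * e - 2 * c - 2 * m ^ 3) * x + (1 - c - m\<^sup>2 * e))"
      unfolding e_def by algebra
    have "0 \<le> (x - m)\<^sup>2 * (x\<^sup>2 + 2 * m * x + e)"
      using x by (intro mult_nonneg_nonneg add_nonneg_nonneg) (auto simp: m_def e_def c_def power2_eq_square)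
    moreover have "0 \<le> 2 * m * e - 2 * c - 2 * m ^ 3" "0 \<le> 1 - c - m\<^sup>2 * e"
      by (auto simp: m_def e_def c_def power2_eq_square power3_eq_cube)
    ultimately have "c * (1 + x)\<^sup>2 \<le> (1 - x)\<^sup>2 * (1 + x)\<^sup>2 + x\<^sup>2"
      using eq x by (smt (verit) mult_nonneg_nonneg)
    moreover have "(1 + x)\<^sup>2 > 0" using x by simp
    ultimately have "c \<le> ((1 - x)\<^sup>2 * (1 + x)\<^sup>2 + x\<^sup>2) / (1 + x)\<^sup>2"
      by (simp only: pos_le_divide_eq)
    also have "\<dots> = c_star_objective x"
      using x by (simp add: c_star_objective_def power_divide add_divide_distrib)
    finally show ?thesis by (simp add: c_def)
  qed
  then show ?thesis
    using c_star_attained by metis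
qed

lemma c_star_upper: "c_star < 0.2333389941"
proof -
  \<comment> \<open>The point is a rounded minimiser; near a stationary point the rounding error
    enters only quadratically.\<close>
  have "c_star \<le> c_star_objective 0.8667604"
    by (rule c_star_le_objective) simp
  also have "\<dots> < 0.2333389941"
    by (simp add: c_star_objective_def power2_eq_square)
  finally show ?thesis .
qed

section \<open>The ratio in the supremum and its maximiser\<close>

text \<open>This is the value at \<open>k\<close> of the Stein solution for the set
  \<open>{0..k - 1}\<close>.\<close>

definition stein_ratio :: "real \<Rightarrow> nat \<Rightarrow> real" where
  "stein_ratio lam k = poisson_cdf lam (k - 1) * poisson_tail lam k / (real k * poisson_mass lam k)"

lemma stein_ratio_Suc:
  "stein_ratio lam (Suc n) = poisson_cdf lam n * poisson_tail lam (Suc n) / (lam * poisson_mass lam n)"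
  unfolding stein_ratio_def poisson_mass_Suc by simp

lemma stein_ratio_pos: "lam > 0 \<Longrightarrow> k \<ge> 1 \<Longrightarrow> stein_ratio lam k > 0"
  unfolding stein_ratio_def
  by (intro divide_pos_pos mult_pos_pos poisson_cdf_pos poisson_tail_pos poisson_mass_pos) auto

lemma inverse_stein_ratio:
  assumes "lam > 0"
  shows "1 / stein_ratio lam (Suc n)
    = lam * poisson_mass lam n / poisson_cdf lam n + lam * poisson_mass lam n / poisson_tail lam (Suc n)"
proof -
  have "1 / (F * Q / c) = c / F + c / Q" if "F > 0" "Q > 0" "F + Q = 1" for F Q c :: real
  proof -
    have "c / F + c / Q = c * (F + Q) / (F * Q)"
      using that(1,2) by (simp add: add_frac_eq algebra_simps)
    then show ?thesis by (simp add: that(3))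
  qed
  then show ?thesis
    unfolding stein_ratio_Suc
    using assms by (simp add: poisson_cdf_pos poisson_tail_pos poisson_cdf_add_tail)
qed

text \<open>The tail summand alone suffices, by \<open>poisson_mean_excess\<close>. The growth makes
  the reciprocal attain its minimum, so the ratio attains its maximum.\<close>

lemma inverse_stein_ratio_ge:
  assumes "lam > 0" "k \<ge> 1"
  shows "real k - lam \<le> 1 / stein_ratio lam k"
proof -
  obtain n where n: "k = Suc n" using assms(2) by (cases k) auto
  have "real k - lam \<le> lam * poisson_mass lam n / poisson_tail lam (Suc n)"
    using poisson_mean_excess[OF assms(1), of n] poisson_tail_pos[OF assms(1), of "Suc n"]
    by (simp add: n pos_le_divide_eq)
  moreover have "0 \<le> lam * poisson_mass lam n / poisson_cdf lam n"
    using assms poisson_mass_pos[of lam n] poisson_cdf_pos[of lam n] by simp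
  ultimately show ?thesis
    using inverse_stein_ratio[OF assms(1), of n] by (simp add: n)
qed

lemma stein_ratio_max_bound:
  assumes lam: "lam > 0" and k: "k \<ge> 1"
    and max: "\<And>m. m \<ge> 1 \<Longrightarrow> stein_ratio lam m \<le> stein_ratio lam k"
  shows "2 * lam + kappa_objective lam k \<le> (1 / stein_ratio lam k)\<^sup>2"
proof -
  obtain n where n: "k = Suc n" using k by (cases k) auto
  define p F Q where "p = poisson_mass lam n" and "F = poisson_cdf lam n" and "Q = poisson_tail lam k"
  have pos: "p > 0" "F > 0" "Q > 0"
    using lam by (auto simp: p_def F_def Q_def poisson_mass_pos poisson_cdf_pos poisson_tail_pos)
  have p': "poisson_mass lam k > 0" "real k * poisson_mass lam k = lam * p"
    using poisson_mass_pos[OF lam] by (simp_all only: n p_def poisson_mass_Suc)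
  have ratio: "stein_ratio lam k = F * Q / (lam * p)"
    unfolding n stein_ratio_Suc by (simp add: F_def Q_def p_def n)
  \<comment> \<open>Comparison with \<open>k + 1\<close>: one mass moves from \<open>Q\<close> to
    \<open>F\<close>, so \<open>k * F' / F\<close> and \<open>k * Q' / Q\<close> become the two
    factors on the left.\<close>
  have right: "(real k + lam * p / F) * (real k - lam * p / Q) \<le> lam * real k"
  proof -
    define F' Q' where "F' = poisson_cdf lam k" and "Q' = poisson_tail lam (Suc k)"
    have F': "F' = F + poisson_mass lam k" and Q': "Q' = Q - poisson_mass lam k"
      using poisson_cdf_Suc[of lam n] poisson_tail_Suc[OF lam, of k]
      by (simp_all add: F'_def Q'_def F_def Q_def n)
    have "F' * Q' / (lam * poisson_mass lam k) \<le> F * Q / (lam * p)"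
      using max[of "Suc k"] unfolding ratio stein_ratio_Suc by (simp add: F'_def Q'_def)
    also have "\<dots> = F * Q / (real k * poisson_mass lam k)"
      by (simp add: p')
    finally have "F' * Q' * real k \<le> lam * (F * Q)"
      using lam k p'(1) by (simp add: field_simps)
    then have "real k * (F' * Q' * real k) / (F * Q) \<le> real k * (lam * (F * Q)) / (F * Q)"
      using pos by (intro divide_right_mono mult_left_mono) auto
    moreover have "real k + lam * p / F = real k * F' / F" "real k - lam * p / Q = real k * Q' / Q"
      using pos by (simp_all add: F' Q' p'(2)[symmetric] field_simps)
    ultimately show ?thesis using pos by (simp add: mult_ac)
  qed
  \<comment> \<open>Comparison with \<open>k - 1\<close>, where the mass \<open>p\<close> moves from
    \<open>F\<close> to \<open>Q\<close>.\<close>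
  have left: "(lam - lam * p / F) * (lam + lam * p / Q) \<le> lam * (real k - 1)"
  proof (cases n)
    \<comment> \<open>At \<open>k = 1\<close> there is no left neighbour, but \<open>F = p\<close>
      makes the first factor vanish, and the right side is 0.\<close>
    case 0
    then show ?thesis using pos by (simp add: n p_def F_def poisson_cdf_0)
  next
    case (Suc r)
    define F' Q' where "F' = poisson_cdf lam r" and "Q' = poisson_tail lam n"
    have F': "F' = F - p" and Q': "Q' = Q + p"
      using poisson_cdf_Suc[of lam r] poisson_tail_Suc[OF lam, of n]
      by (simp_all add: F'_def Q'_def F_def Q_def p_def n Suc)
    have q: "lam * poisson_mass lam r = real n * p" "real n > 0"
      using poisson_mass_Suc[of r lam] by (simp_all only: Suc p_def of_nat_0_less_iff zero_less_Suc)
    have "stein_ratio lam n = F' * Q' / (real n * p)"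
      using stein_ratio_Suc[of lam r] unfolding q(1)[symmetric] by (simp only: Suc F'_def Q'_def)
    then have "F' * Q' / (real n * p) \<le> F * Q / (lam * p)"
      using max[of n] unfolding ratio by (simp add: Suc)
    then have "F' * Q' * lam \<le> real n * (F * Q)"
      using lam pos q(2) by (simp add: field_simps)
    then have "lam * (F' * Q' * lam) / (F * Q) \<le> lam * (real n * (F * Q)) / (F * Q)"
      using pos lam by (intro divide_right_mono mult_left_mono) auto
    moreover have "lam - lam * p / F = lam * F' / F" "lam + lam * p / Q = lam * Q' / Q"
      using pos by (simp_all add: F' Q' field_simps)
    ultimately show ?thesis using pos by (simp add: mult_ac n)
  qed
  have "1 / stein_ratio lam k = lam * p / F + lam * p / Q"
    using inverse_stein_ratio[OF lam, of n] by (simp add: n p_def F_def Q_def)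
  then show ?thesis
    unfolding kappa_objective_def
    using stationary_sum_bound[OF _ lam right left] k by simp
qed

text \<open>The objective matters only at the maximiser of the ratio, whose position is unknown, so
  \<open>K\<close> must lie below all values. It is instantiated with
  \<open>2 * lam + kappaP lam\<close>, \<open>2 * lam + c_star\<close> and 1.\<close>

lemma C0P_le:
  assumes lam: "lam > 0" and K: "K > 0"
    and le: "\<And>k. k \<ge> 1 \<Longrightarrow> K \<le> 2 * lam + kappa_objective lam k"
  shows "C0P lam \<le> ereal (1 / sqrt K)"
proof -
  obtain k where k: "k \<ge> 1" "\<And>m. m \<ge> 1 \<Longrightarrow> 1 / stein_ratio lam k \<le> 1 / stein_ratio lam m"
    using attains_min_if_linear_growth[of lam "\<lambda>k. 1 / stein_ratio lam k"] inverse_stein_ratio_ge[OF lam]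
    by blast
  have max: "stein_ratio lam m \<le> stein_ratio lam k" if "m \<ge> 1" for m
    using k(2)[OF that] stein_ratio_pos[OF lam that] stein_ratio_pos[OF lam k(1)]
    by (simp add: field_simps)
  have "K \<le> (1 / stein_ratio lam k)\<^sup>2"
    using stein_ratio_max_bound[OF lam k(1) max] le[OF k(1)] by simp
  then have "sqrt K \<le> 1 / stein_ratio lam k"
    using stein_ratio_pos[OF lam k(1)] by (intro real_le_lsqrt) auto
  then have "stein_ratio lam k \<le> 1 / sqrt K"
    using stein_ratio_pos[OF lam k(1)] K by (simp add: field_simps)
  then have "stein_ratio lam m \<le> 1 / sqrt K" if "m \<ge> 1" for m
    using max[OF that] by simp
  then show ?thesis
    unfolding C0P_def by (intro SUP_least) (auto simp: stein_ratio_def)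
qed

theorem corollary4p2:
  fixes lam :: real
  assumes "lam > 0"
  shows "(\<exists>k\<ge>1. kappaP lam = kappa_objective lam k \<and> (\<forall>m\<ge>1. kappa_objective lam k \<le> kappa_objective lam m))
    \<and> C0P lam \<le> ereal (1 / sqrt (2 * lam + kappaP lam))
    \<and> (\<exists>x\<in>{0..1}. c_star = c_star_objective x \<and> (\<forall>y\<in>{0..1}. c_star_objective x \<le> c_star_objective y))
    \<and> 0.2333389940 \<le> c_star \<and> c_star < 0.2333389941
    \<and> C0P lam \<le> ereal (min 1 (1 / sqrt (2 * lam + c_star)))"
proof -
  obtain k where k: "k \<ge> 1" "kappaP lam = kappa_objective lam k"
      "\<forall>m\<ge>1. kappa_objective lam k \<le> kappa_objective lam m"
    using kappaP_attained by blast
  have "C0P lam \<le> ereal (1 / sqrt (2 * lam + kappaP lam))"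
    using k two_lam_add_kappa_objective_ge_1[OF k(1), of lam] by (intro C0P_le[OF assms]) auto
  moreover have "C0P lam \<le> ereal (1 / sqrt (2 * lam + c_star))"
    using assms c_star_lower c_star_le_kappa_objective by (intro C0P_le[OF assms]) auto
  moreover have "C0P lam \<le> ereal (1 / sqrt 1)"
    using two_lam_add_kappa_objective_ge_1 by (intro C0P_le[OF assms]) auto
  ultimately show ?thesis
    using kappaP_attained c_star_attained c_star_lower c_star_upper by (auto simp: min_def)
qed

end
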